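(* Let $Y$ be a centered non-degenerate random vector in $\mathbb{R}^d$ with finite second moment and with law $\mu_Y$, and let $\nu$ be a Lévy measure on $\mathbb{R}^d$ such that $\int_{\|u\|\ge1}\|u\|^2\nu(du)<+\infty$. Assume that $\nu\ast\mu_Y\ll\mu_Y$ and that $Y$ satisfies the following Poincaré inequality for some $0<U_Y<+\infty$: for all $f\in H_\nu(\mu_Y)$, $$\mathbb{E}\|f(Y)-\mathbb{E}f(Y)\|^2\le U_Y\,\mathbb{E}\int_{\mathbb{R}^d}\|f(Y+u)-f(Y)\|^2\nu(du).$$ Then there exists a unique $\tau_Y\in H_{\nu,0}(\mu_Y)$ such that, for all $f\in H_{\nu,0}(\mu_Y)$, $$A(f,\tau_Y)=L(f).$$ Moreover, $$\mathbb{E}\int_{\mathbb{R}^d}\|\tau_Y(Y+u)-\tau_Y(Y)\|^2\nu(du)\le U_Y\,\mathbb{E}\|Y\|^2.$$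
   Context: $\|\cdot\|$ and $\langle\cdot;\cdot\rangle$ are the Euclidean norm and inner product on $\mathbb{R}^d$, $d\ge1$. A Lévy measure is a positive Borel measure $\nu$ on $\mathbb{R}^d$ with $\nu(\{0\})=0$ and $\int(1\wedge\|u\|^2)\nu(du)<\infty$. Non-degenerate means that the support of the law is not contained in a $(d-1)$-dimensional subspace of $\mathbb{R}^d$. $\nu\ast\mu_Y$ is the convolution of the positive measures $\nu$ and $\mu_Y$; $\mu_1\ll\mu_2$ denotes absolute continuity of $\mu_1$ with respect to $\mu_2$. $H_\nu(\mu_Y)$ is the vector space of Borel measurable functions $f:\mathbb{R}^d\to\mathbb{R}^d$ (identified when equal $\mu_Y$-a.e.) such that $\int\|f(y)\|^2\mu_Y(dy)<\infty$ and $\int\int\|f(y+u)-f(y)\|^2\nu(du)\mu_Y(dy)<\infty$; $H_{\nu,0}(\mu_Y)$ is the subspace of those $f$ with $\mathbb{E}f(Y)=0$. The bilinear functional $A$ and the linear functional $L$ are $$A(f,g)=\mathbb{E}\int_{\mathbb{R}^d}\langle f(Y+u)-f(Y);g(Y+u)-g(Y)\rangle\nu(du),\qquad L(f)=\mathbb{E}\langle Y;f(Y)\rangle.$$ *)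

theory Defs
  imports "HOL-Probability.Probability"
begin

definition measure_support :: "'a::topological_space measure \<Rightarrow> 'a set" where
  "measure_support \<mu> = {x. \<forall>U. open U \<longrightarrow> x \<in> U \<longrightarrow> emeasure \<mu> U > 0}"

definition nondegenerate_law :: "'a::euclidean_space measure \<Rightarrow> bool" where
  "nondegenerate_law \<mu> \<longleftrightarrow>
     \<not> (\<exists>S. subspace S \<and> dim S = DIM('a) - 1 \<and> measure_support \<mu> \<subseteq> S)"

definition levy_measure :: "'a::euclidean_space measure \<Rightarrow> bool" where
  "levy_measure \<nu> \<longleftrightarrow>
     sets \<nu> = sets borel \<and> emeasure \<nu> {0} = 0 \<and>
     (\<integral>\<^sup>+u. ennreal (min 1 ((norm u)\<^sup>2)) \<partial>\<nu>) < \<infinity>"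

text \<open>
  The quadratic energy of \<open>f\<close>, as an extended nonnegative integral (possibly infinite).
\<close>

definition jump_energy ::
    "'a::euclidean_space measure \<Rightarrow> 'a measure \<Rightarrow> ('a \<Rightarrow> 'a) \<Rightarrow> ennreal" where
  "jump_energy \<nu> \<mu> f =
     (\<integral>\<^sup>+y. (\<integral>\<^sup>+u. ennreal ((norm (f (y + u) - f y))\<^sup>2) \<partial>\<nu>) \<partial>\<mu>)"

text \<open>
  The spaces consist of functions rather than of classes of functions; the identification of
  functions equal \<open>\<mu>\<close>-almost everywhere is made explicit wherever it matters, namely
  in uniqueness claims.
\<close>

definition H_space :: "'a::euclidean_space measure \<Rightarrow> 'a measure \<Rightarrow> ('a \<Rightarrow> 'a) set" where
  "H_space \<nu> \<mu> = {f. f \<in> borel_measurable borel \<and>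
     (\<integral>\<^sup>+y. ennreal ((norm (f y))\<^sup>2) \<partial>\<mu>) < \<infinity> \<and>
     jump_energy \<nu> \<mu> f < \<infinity>}"

definition H0_space :: "'a::euclidean_space measure \<Rightarrow> 'a measure \<Rightarrow> ('a \<Rightarrow> 'a) set" where
  "H0_space \<nu> \<mu> = {f \<in> H_space \<nu> \<mu>. (\<integral>y. f y \<partial>\<mu>) = 0}"

text \<open>
  In the next two definitions \<open>\<mu>\<close> is the law of \<open>Y\<close>: expectations of functions
  of \<open>Y\<close> are integrals with respect to \<open>\<mu>\<close>. The Bochner integrals are used only for
  arguments where they converge: for \<open>f\<close> and \<open>g\<close> in the space above, by Cauchy-Schwarz (for the
  inner integral, for \<open>\<mu>\<close>-almost every \<open>y\<close>), and in the linear form when \<open>Y\<close> is also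
  square integrable.
\<close>

definition A_form ::
    "'a::euclidean_space measure \<Rightarrow> 'a measure \<Rightarrow> ('a \<Rightarrow> 'a) \<Rightarrow> ('a \<Rightarrow> 'a) \<Rightarrow> real" where
  "A_form \<nu> \<mu> f g =
     (\<integral>y. (\<integral>u. inner (f (y + u) - f y) (g (y + u) - g y) \<partial>\<nu>) \<partial>\<mu>)"

definition L_form :: "'a::euclidean_space measure \<Rightarrow> ('a \<Rightarrow> 'a) \<Rightarrow> real" where
  "L_form \<mu> f = (\<integral>y. inner y (f y) \<partial>\<mu>)"

definition poincare_inequality ::
    "'a::euclidean_space measure \<Rightarrow> 'a measure \<Rightarrow> real \<Rightarrow> bool" where
  "poincare_inequality \<nu> \<mu> U \<longleftrightarrow>
     (\<forall>f \<in> H_space \<nu> \<mu>.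
        (\<integral>\<^sup>+y. ennreal ((norm (f y - (\<integral>z. f z \<partial>\<mu>)))\<^sup>2) \<partial>\<mu>)
          \<le> ennreal U * jump_energy \<nu> \<mu> f)"

end

theory Submission
  imports Defs
begin

text \<open>
  By Tonelli, \<open>A\<close> is the \<open>L\<^sup>2(\<mu> \<otimes> \<nu>)\<close> inner product of the increments
  \<open>f (y + u) - f y\<close>. The Poincare inequality makes it positive definite on the centered
  functions and makes \<open>L\<close> bounded for it, so \<open>\<tau>\<close> is the Riesz representative of \<open>L\<close>, obtained by
  minimizing \<open>A f f - 2 L f\<close>. For completeness, an \<open>A\<close>-Cauchy sequence is \<open>L\<^sup>2(\<mu>)\<close>-Cauchy by the
  Poincare inequality, hence converges \<open>\<mu>\<close>-almost everywhere along a subsequence; because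
  \<open>\<nu> \<star> \<mu>\<close> is absolutely continuous with respect to \<open>\<mu>\<close>, the increments converge
  \<open>\<mu> \<otimes> \<nu>\<close>-almost everywhere too, and Fatou's lemma applies to both integrals.
\<close>

section \<open>Riesz representation for a semidefinite form\<close>

text \<open>If r > 0, evaluate the quadratic at its minimizer s = -q/r; if r = 0, an affine function
  bounded below is constant. It yields both Cauchy-Schwarz and the rate at which a minimizing
  sequence nearly represents \<open>l\<close>.\<close>

lemma nonneg_quadratic_discriminant:
  fixes p q r :: real
  assumes nonneg: "\<And>s. 0 \<le> p + 2 * s * q + s\<^sup>2 * r" and r: "0 \<le> r"
  shows "q\<^sup>2 \<le> p * r"
proof (cases "r = 0")
  case True
  have "q = 0"
  proof (rule ccontr)
    assume "q \<noteq> 0"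
    \<comment> \<open>At this s the affine function p + 2 s q takes the value -1.\<close>
    then show False
      using nonneg[of "- (p + 1) / (2 * q)"] True by (simp add: field_simps)
  qed
  then show ?thesis using True by simp
next
  case False
  with r have "r > 0" by simp
  have "0 \<le> (p + 2 * (- q / r) * q + (- q / r)\<^sup>2 * r) * r"
    using nonneg[of "- q / r"] r by simp
  also have "\<dots> = p * r - q\<^sup>2"
    using \<open>r > 0\<close> by (simp add: field_simps power2_eq_square)
  finally show ?thesis by simp
qed

text \<open>Only semidefiniteness is asked, since functions are not identified almost everywhere.
  Symmetry and positivity are asked of all functions: integral forms have them even off
  \<open>S\<close>, because a divergent Bochner integral is 0 by convention.\<close>

locale semidefinite_form =
  fixes S :: "('x \<Rightarrow> 'e::real_vector) set" and a :: "('x \<Rightarrow> 'e) \<Rightarrow> ('x \<Rightarrow> 'e) \<Rightarrow> real"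
  assumes comb_closed: "\<And>f g c. f \<in> S \<Longrightarrow> g \<in> S \<Longrightarrow> (\<lambda>x. f x + c *\<^sub>R g x) \<in> S"
    and form_sym: "\<And>f g. a f g = a g f"
    and form_comb: "\<And>f g h c. f \<in> S \<Longrightarrow> g \<in> S \<Longrightarrow> h \<in> S \<Longrightarrow>
          a (\<lambda>x. f x + c *\<^sub>R g x) h = a f h + c * a g h"
    and form_nonneg: "\<And>f. 0 \<le> a f f"
begin

lemma diff_closed: "f \<in> S \<Longrightarrow> g \<in> S \<Longrightarrow> (\<lambda>x. f x - g x) \<in> S"
  using comb_closed[of f g "-1"] by simp

lemma form_diff:
  "f \<in> S \<Longrightarrow> g \<in> S \<Longrightarrow> h \<in> S \<Longrightarrow> a (\<lambda>x. f x - g x) h = a f h - a g h"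
  using form_comb[of f g h "-1"] by simp

lemma form_comb_square:
  assumes "f \<in> S" "g \<in> S"
  shows "a (\<lambda>x. f x + c *\<^sub>R g x) (\<lambda>x. f x + c *\<^sub>R g x) = a f f + 2 * c * a f g + c\<^sup>2 * a g g"
proof -
  let ?k = "\<lambda>x. f x + c *\<^sub>R g x"
  have "a ?k ?k = a f ?k + c * a g ?k"
    using assms comb_closed by (intro form_comb) auto
  also have "\<dots> = a ?k f + c * a ?k g"
    by (simp add: form_sym)
  also have "\<dots> = a f f + 2 * c * a f g + c\<^sup>2 * a g g"
    using assms by (simp add: form_comb form_sym[of g f] algebra_simps power2_eq_square)
  finally show ?thesis .
qed

lemma form_Cauchy_Schwarz:
  assumes "f \<in> S" "g \<in> S"
  shows "(a f g)\<^sup>2 \<le> a f f * a g g"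
proof (rule nonneg_quadratic_discriminant)
  show "0 \<le> a f f + 2 * s * a f g + s\<^sup>2 * a g g" for s
    using form_nonneg form_comb_square[OF assms, of s] by metis
qed (rule form_nonneg)

text \<open>The limit \<open>t\<close> of a minimizing sequence is never shown to attain the
  infimum. Near-minimality of \<open>F n\<close> already makes \<open>a (F n) h - l h\<close> small
  for every \<open>h\<close>, and Cauchy-Schwarz carries this to \<open>t\<close>.\<close>

theorem riesz_representation:
  assumes nonempty: "S \<noteq> {}"
    and l_comb: "\<And>f g c. f \<in> S \<Longrightarrow> g \<in> S \<Longrightarrow> l (\<lambda>x. f x + c *\<^sub>R g x) = l f + c * l g"
    and l_bound: "\<And>f. f \<in> S \<Longrightarrow> (l f)\<^sup>2 \<le> C * a f f" and C: "0 \<le> C"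
    and complete: "\<And>F. (\<And>n. F n \<in> S) \<Longrightarrow>
          (\<And>e. e > 0 \<Longrightarrow> \<exists>N. \<forall>i\<ge>N. \<forall>j\<ge>N. a (\<lambda>x. F i x - F j x) (\<lambda>x. F i x - F j x) < e) \<Longrightarrow>
          \<exists>t\<in>S. (\<lambda>n. a (\<lambda>x. F n x - t x) (\<lambda>x. F n x - t x)) \<longlonglongrightarrow> (0::real)"
  shows "\<exists>t\<in>S. \<forall>f\<in>S. a f t = l f"
proof -
  define Q where "Q f = a f f - 2 * l f" for f
  define m where "m = (INF f\<in>S. Q f)"
  have Q_comb: "Q (\<lambda>x. f x + c *\<^sub>R g x) = Q f + 2 * c * (a f g - l g) + c\<^sup>2 * a g g"
    if "f \<in> S" "g \<in> S" for f g c
    using that by (simp add: Q_def form_comb_square l_comb algebra_simps)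
  have Q_lower: "- C \<le> Q f" if "f \<in> S" for f
  proof -
    \<comment> \<open>This is the inequality of arithmetic and geometric means for \<open>C\<close>
      and \<open>a f f\<close>, in squared form to avoid square roots.\<close>
    have "(2 * l f)\<^sup>2 \<le> (a f f + C)\<^sup>2"
    proof -
      have "(2 * l f)\<^sup>2 = 4 * (l f)\<^sup>2" by simp
      also have "\<dots> \<le> 4 * (C * a f f) + (a f f - C)\<^sup>2"
        using l_bound[OF that] by (intro add_increasing2) auto
      also have "\<dots> = (a f f + C)\<^sup>2" by algebra
      finally show ?thesis .
    qed
    then have "2 * l f \<le> a f f + C"
      by (rule power2_le_imp_le) (use form_nonneg[of f] C in simp)
    then show ?thesis by (simp add: Q_def)
  qed
  then have bdd: "bdd_below (Q ` S)" by (intro bdd_belowI2)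
  have m_le: "m \<le> Q f" if "f \<in> S" for f
    unfolding m_def using bdd that by (rule cINF_lower)
  have "\<exists>f\<in>S. Q f < m + 1 / real (Suc n)" for n
    using cINF_less_iff[OF nonempty bdd, of "m + 1 / real (Suc n)"] by (simp add: m_def)
  then obtain F where F: "\<And>n. F n \<in> S" and QF: "\<And>n. Q (F n) < m + 1 / real (Suc n)"
    by metis
  have dist_bound: "a (\<lambda>x. F i x - F j x) (\<lambda>x. F i x - F j x)
      \<le> 2 * (1 / real (Suc i) + 1 / real (Suc j))" for i j
  proof -
    let ?d = "\<lambda>x. F i x - F j x"
    have d: "?d \<in> S" using F by (intro diff_closed)
    \<comment> \<open>Along the line from \<open>F i\<close> to \<open>F j\<close>, c = -1 gives the
      endpoint and c = -1/2 the midpoint, where \<open>Q\<close> is at least \<open>m\<close>.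
      Eliminating the linear term from the two relations is the parallelogram argument.\<close>
    have "(\<lambda>x. F i x + (-1) *\<^sub>R ?d x) = F j" by auto
    then have "Q (F j) = Q (F i) - 2 * (a (F i) ?d - l ?d) + a ?d ?d"
      using Q_comb[OF F d, of i "-1"] by simp
    moreover have "m \<le> Q (F i) - (a (F i) ?d - l ?d) + a ?d ?d / 4"
      using m_le[OF comb_closed[OF F d, of i "-1/2"]] Q_comb[OF F d, of i "-1/2"]
      by (simp add: power2_eq_square)
    ultimately show ?thesis using QF[of i] QF[of j] by simp
  qed
  have "\<exists>N. \<forall>i\<ge>N. \<forall>j\<ge>N. a (\<lambda>x. F i x - F j x) (\<lambda>x. F i x - F j x) < e" if "e > 0" for e
  proof -
    have "0 < e / 4" using that by simp
    then obtain N where N: "1 / real (Suc N) < e / 4"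
      by (rule nat_approx_posE)
    show ?thesis
    proof (intro exI allI impI)
      fix i j assume "N \<le> i" "N \<le> j"
      then have "1 / real (Suc i) \<le> 1 / real (Suc N)" "1 / real (Suc j) \<le> 1 / real (Suc N)"
        by (auto simp: frac_le)
      then have "2 * (1 / real (Suc i) + 1 / real (Suc j)) \<le> 2 * (1 / real (Suc N) + 1 / real (Suc N))"
        by (intro mult_left_mono add_mono) auto
      also have "\<dots> < e" using N by simp
      finally show "a (\<lambda>x. F i x - F j x) (\<lambda>x. F i x - F j x) < e"
        using dist_bound[of i j] by (rule le_less_trans[rotated])
    qed
  qed
  from complete[OF F this] obtain t where t: "t \<in> S"
    and lim: "(\<lambda>n. a (\<lambda>x. F n x - t x) (\<lambda>x. F n x - t x)) \<longlonglongrightarrow> 0"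
    by blast
  have "a t h = l h" if h: "h \<in> S" for h
  proof -
    let ?d = "\<lambda>n x. F n x - t x"
    have "(a t h - l h)\<^sup>2 \<le> 2 * (1 / real (Suc n) * a h h + a (?d n) (?d n) * a h h)" for n
    proof -
      \<comment> \<open>Moving from \<open>F n\<close> in the direction \<open>h\<close> lowers
        \<open>Q\<close> by less than 1/(n+1), whatever the step s; the discriminant of this
        quadratic in s gives the bound.\<close>
      have 1: "(a (F n) h - l h)\<^sup>2 \<le> 1 / real (Suc n) * a h h"
      proof (rule nonneg_quadratic_discriminant)
        show "0 \<le> 1 / real (Suc n) + 2 * s * (a (F n) h - l h) + s\<^sup>2 * a h h" for s
          using m_le[OF comb_closed[OF F h, of n s]] Q_comb[OF F h, of n s] QF[of n] by linarith
      qed (rule form_nonneg)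
      have 2: "(a (F n) h - a t h)\<^sup>2 \<le> a (?d n) (?d n) * a h h"
        using form_Cauchy_Schwarz[OF diff_closed[OF F t] h, of n] form_diff[OF F t h, of n] by simp
      have "(a t h - l h)\<^sup>2 \<le> 2 * ((a (F n) h - l h)\<^sup>2 + (a (F n) h - a t h)\<^sup>2)"
        using zero_le_power2[of "(a (F n) h - l h) + (a (F n) h - a t h)"]
        by (simp add: power2_eq_square algebra_simps)
      also have "\<dots> \<le> 2 * (1 / real (Suc n) * a h h + a (?d n) (?d n) * a h h)"
        using add_mono[OF 1 2] by (rule mult_left_mono) simp
      finally show ?thesis .
    qed
    moreover have "(\<lambda>n. 2 * (1 / real (Suc n) * a h h + a (?d n) (?d n) * a h h))
        \<longlonglongrightarrow> 2 * (0 * a h h + 0 * a h h)"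
      using lim LIMSEQ_inverse_real_of_nat
      by (intro tendsto_intros) (auto simp: inverse_eq_divide)
    ultimately have "(a t h - l h)\<^sup>2 \<le> 2 * (0 * a h h + 0 * a h h)"
      by (intro LIMSEQ_le_const) auto
    then show ?thesis by simp
  qed
  then show ?thesis using t form_sym by metis
qed

end

section \<open>Square integrable functions\<close>

definition square_integrable :: "'x measure \<Rightarrow> ('x \<Rightarrow> 'e::euclidean_space) \<Rightarrow> bool" where
  "square_integrable M f \<longleftrightarrow> f \<in> borel_measurable M \<and> integrable M (\<lambda>x. (norm (f x))\<^sup>2)"

lemma square_integrable_iff_nn_integral:
  "square_integrable M f \<longleftrightarrow>
     f \<in> borel_measurable M \<and> (\<integral>\<^sup>+x. ennreal ((norm (f x))\<^sup>2) \<partial>M) < \<infinity>"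
  by (auto simp: square_integrable_def integrable_iff_bounded)

lemma square_integrable_comb:
  assumes "square_integrable M f" "square_integrable M g"
  shows "square_integrable M (\<lambda>x. f x + c *\<^sub>R g x)"
  unfolding square_integrable_def
proof
  have [measurable]: "f \<in> borel_measurable M" "g \<in> borel_measurable M"
    using assms by (auto simp: square_integrable_def)
  show "(\<lambda>x. f x + c *\<^sub>R g x) \<in> borel_measurable M" by measurable
  have "integrable M (\<lambda>x. 2 * (norm (f x))\<^sup>2 + 2 * c\<^sup>2 * (norm (g x))\<^sup>2)"
    using assms unfolding square_integrable_def
    by (intro Bochner_Integration.integrable_add integrable_mult_right) blast+
  then show "integrable M (\<lambda>x. (norm (f x + c *\<^sub>R g x))\<^sup>2)"
  proof (rule Bochner_Integration.integrable_bound)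
    have "(norm (v + c *\<^sub>R w))\<^sup>2 \<le> 2 * (norm v)\<^sup>2 + 2 * c\<^sup>2 * (norm w)\<^sup>2" for v w :: 'b
    proof -
      have "0 \<le> (norm (v - c *\<^sub>R w))\<^sup>2" by simp
      then show ?thesis
        unfolding power2_norm_eq_inner
        by (simp add: inner_simps inner_commute power2_eq_square algebra_simps)
    qed
    then show "AE x in M. norm ((norm (f x + c *\<^sub>R g x))\<^sup>2)
        \<le> norm (2 * (norm (f x))\<^sup>2 + 2 * c\<^sup>2 * (norm (g x))\<^sup>2)"
      by (auto intro!: AE_I2 order_trans[OF _ abs_ge_self])
  qed measurable
qed

lemma square_integrable_diff:
  "square_integrable M f \<Longrightarrow> square_integrable M g \<Longrightarrow> square_integrable M (\<lambda>x. f x - g x)"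
  using square_integrable_comb[of M f g "-1"] by simp

lemma square_integrable_inner:
  assumes "square_integrable M f" "square_integrable M g"
  shows "integrable M (\<lambda>x. inner (f x) (g x))"
proof -
  have [measurable]: "f \<in> borel_measurable M" "g \<in> borel_measurable M"
    using assms by (auto simp: square_integrable_def)
  have "integrable M (\<lambda>x. (norm (f x))\<^sup>2 + (norm (g x))\<^sup>2)"
    using assms unfolding square_integrable_def
    by (intro Bochner_Integration.integrable_add integrable_mult_right) blast+
  then show ?thesis
  proof (rule Bochner_Integration.integrable_bound)
    have "\<bar>inner v w\<bar> \<le> (norm v)\<^sup>2 + (norm w)\<^sup>2" for v w :: 'b
    proof -
      have "2 * (norm v * norm w) \<le> (norm v)\<^sup>2 + (norm w)\<^sup>2"
        using sum_squares_bound[of "norm v" "norm w"] by simp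
      then show ?thesis
        using Cauchy_Schwarz_ineq2[of v w] mult_nonneg_nonneg[of "norm v" "norm w"] by simp
    qed
    then show "AE x in M. norm (inner (f x) (g x)) \<le> norm ((norm (f x))\<^sup>2 + (norm (g x))\<^sup>2)"
      by auto
  qed measurable
qed

text \<open>The measure stays a parameter, so that the same facts serve \<open>\<mu>\<close> and the
  product of \<open>\<mu>\<close> and \<open>\<nu>\<close>.\<close>

interpretation L2: semidefinite_form "{f. square_integrable M f}"
  "\<lambda>f g. \<integral>x. inner (f x) (g x) \<partial>M" for M
  by unfold_locales
    (auto simp: square_integrable_comb square_integrable_inner inner_simps inner_commute)

lemma nn_integral_norm_square:
  assumes "square_integrable M f"
  shows "(\<integral>\<^sup>+x. ennreal ((norm (f x))\<^sup>2) \<partial>M) = ennreal (\<integral>x. inner (f x) (f x) \<partial>M)"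
  using assms
  by (simp add: square_integrable_def nn_integral_eq_integral flip: power2_norm_eq_inner)

lemma (in prob_space) square_integrable_imp_integrable:
  assumes "square_integrable M f"
  shows "integrable M f"
  using assms square_integrable_imp_integrable[of "\<lambda>x. norm (f x)"]
  by (auto simp: square_integrable_def intro: integrable_norm_cancel)

text \<open>Cauchy-Schwarz against the constant 1, whose norm is 1 under a probability
  measure.\<close>

lemma (in prob_space) expectation_norm_square_le:
  fixes f :: "'a \<Rightarrow> 'e::euclidean_space"
  assumes "square_integrable M f"
  shows "(\<integral>x. norm (f x) \<partial>M)\<^sup>2 \<le> (\<integral>x. inner (f x) (f x) \<partial>M)"
proof -
  have "square_integrable M (\<lambda>x. norm (f x))" "square_integrable M (\<lambda>x. 1::real)"
    using assms by (auto simp: square_integrable_def)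
  then show ?thesis
    using L2.form_Cauchy_Schwarz[of "\<lambda>x. norm (f x)" M "\<lambda>x. 1"]
    by (simp add: prob_space power2_norm_eq_inner flip: power2_eq_square)
qed

text \<open>Fatou's lemma makes the squared distance to a fixed \<open>g\<close> lower
  semicontinuous under almost everywhere convergence. The bound is only eventual because it will be
  known once a subsequence has entered a Cauchy tail.\<close>

lemma Fatou_norm_square_diff:
  fixes F :: "nat \<Rightarrow> 'x \<Rightarrow> 'e::euclidean_space"
  assumes [measurable]: "\<And>n. F n \<in> borel_measurable M" "g \<in> borel_measurable M"
    and lim: "AE x in M. (\<lambda>n. F n x) \<longlonglongrightarrow> f x"
    and bound: "\<forall>\<^sub>F n in sequentially. (\<integral>\<^sup>+x. ennreal ((norm (g x - F n x))\<^sup>2) \<partial>M) \<le> C"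
  shows "(\<integral>\<^sup>+x. ennreal ((norm (g x - f x))\<^sup>2) \<partial>M) \<le> C"
proof -
  have "(\<integral>\<^sup>+x. ennreal ((norm (g x - f x))\<^sup>2) \<partial>M)
      = (\<integral>\<^sup>+x. liminf (\<lambda>n. ennreal ((norm (g x - F n x))\<^sup>2)) \<partial>M)"
  proof (rule nn_integral_cong_AE, use lim in eventually_elim)
    case (elim x)
    then have "(\<lambda>n. ennreal ((norm (g x - F n x))\<^sup>2)) \<longlonglongrightarrow> ennreal ((norm (g x - f x))\<^sup>2)"
      by (intro tendsto_ennrealI tendsto_intros)
    then show ?case using lim_imp_Liminf[OF trivial_limit_sequentially] by metis
  qed
  also have "\<dots> \<le> liminf (\<lambda>n. \<integral>\<^sup>+x. ennreal ((norm (g x - F n x))\<^sup>2) \<partial>M)"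
    by (rule nn_integral_liminf) measurable
  also have "\<dots> \<le> C"
    by (rule order_trans[OF Liminf_le_Limsup[OF trivial_limit_sequentially] Limsup_bounded[OF bound]])
  finally show ?thesis .
qed

section \<open>The jump form\<close>

text \<open>On \<open>B n\<close> the integrand \<open>min 1 ((norm u)\<^sup>2)\<close> is at least
  1/(n+1)^2, so Markov's inequality makes the mass of \<open>B n\<close> finite. These sets exhaust
  everything but the origin, which is a null set. Sigma-finiteness is what Tonelli and Fubini
  require of \<open>\<nu>\<close>.\<close>

lemma levy_measure_sigma_finite:
  assumes "levy_measure \<nu>"
  shows "sigma_finite_measure \<nu>"
proof
  have [measurable_cong]: "sets \<nu> = sets borel" and zero: "emeasure \<nu> {0} = 0"
    and fin: "(\<integral>\<^sup>+u. ennreal (min 1 ((norm u)\<^sup>2)) \<partial>\<nu>) < \<infinity>"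
    using assms by (auto simp: levy_measure_def)
  have space: "space \<nu> = UNIV"
    using sets_eq_imp_space_eq[OF \<open>sets \<nu> = sets borel\<close>] by simp
  define B :: "nat \<Rightarrow> 'a set" where "B n = {u. 1 / real (Suc n) \<le> norm u}" for n
  have B_fin: "emeasure \<nu> (B n) < \<infinity>" for n
  proof -
    let ?c = "ennreal ((real (Suc n))\<^sup>2)"
    have "1 \<le> ?c * ennreal (min 1 ((norm u)\<^sup>2))" if "u \<in> B n" for u
    proof -
      have "1 \<le> real (Suc n) * norm u"
        using that by (simp add: B_def field_simps)
      then have "1 \<le> (real (Suc n) * norm u)\<^sup>2"
        by (rule one_le_power)
      moreover have "1 \<le> (real (Suc n))\<^sup>2"
        by (rule one_le_power) simp
      ultimately have "1 \<le> (real (Suc n))\<^sup>2 * min 1 ((norm u)\<^sup>2)"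
        by (simp only: min_def power_mult_distrib split: if_split) simp
      then show ?thesis
        by (simp only: ennreal_1[symmetric] ennreal_mult'[symmetric] zero_le_power2 ennreal_leI)
    qed
    then have "emeasure \<nu> (B n) \<le> emeasure \<nu> {u \<in> UNIV. 1 \<le> ?c * ennreal (min 1 ((norm u)\<^sup>2))}"
      by (intro emeasure_mono) auto
    also have "\<dots> \<le> ?c * (\<integral>\<^sup>+u. ennreal (min 1 ((norm u)\<^sup>2)) * indicator UNIV u \<partial>\<nu>)"
      by (rule nn_integral_Markov_inequality) (auto simp: space[symmetric])
    also have "\<dots> < \<infinity>"
      using fin by (simp add: ennreal_mult_less_top)
    finally show ?thesis .
  qed
  show "\<exists>A. countable A \<and> A \<subseteq> sets \<nu> \<and> \<Union> A = space \<nu> \<and> (\<forall>a\<in>A. emeasure \<nu> a \<noteq> \<infinity>)"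
  proof (intro exI conjI)
    show "countable (insert {0} (range B))" by simp
    show "insert {0} (range B) \<subseteq> sets \<nu>" by (auto simp: B_def)
    have "\<exists>n. u \<in> B n" if "u \<noteq> 0" for u
    proof -
      have "0 < norm u" using that by simp
      then obtain n where "1 / real (Suc n) < norm u" by (rule nat_approx_posE)
      then show ?thesis by (auto simp: B_def intro!: exI[of _ n])
    qed
    then show "\<Union> (insert {0} (range B)) = space \<nu>" by (auto simp: space)
    show "\<forall>a\<in>insert {0} (range B). emeasure \<nu> a \<noteq> \<infinity>"
      using B_fin zero by (auto simp: less_top)
  qed
qed

definition increment :: "('a::real_vector \<Rightarrow> 'a) \<Rightarrow> 'a \<times> 'a \<Rightarrow> 'a" where
  "increment f = (\<lambda>(y, u). f (y + u) - f y)"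

lemma increment_comb:
  "increment (\<lambda>x. f x + c *\<^sub>R g x) = (\<lambda>z. increment f z + c *\<^sub>R increment g z)"
  by (auto simp: increment_def algebra_simps)

lemma increment_diff:
  "increment (\<lambda>x. f x - g x) = (\<lambda>z. increment f z - increment g z)"
  by (auto simp: increment_def algebra_simps)

text \<open>The setting is phrased through the law \<open>\<mu>\<close> alone, the second moment of
  Y becoming square integrability of the identity. The sort \<open>ordered_euclidean_space\<close>
  is the one over which \<open>\<star>\<close> is defined.\<close>

locale poincare_jump =
  fixes \<mu> \<nu> :: "'a::ordered_euclidean_space measure" and U :: real
  assumes law: "prob_space \<mu>"
    and sets_mu [measurable_cong]: "sets \<mu> = sets borel"
    and levy: "levy_measure \<nu>"
    and conv_ac: "absolutely_continuous \<mu> (\<nu> \<star> \<mu>)"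
    and U_pos: "0 < U"
    and poincare: "poincare_inequality \<nu> \<mu> U"
    and square_integrable_id: "square_integrable \<mu> (\<lambda>y. y)"
begin

sublocale mu: prob_space \<mu>
  by (rule law)

sublocale nu: sigma_finite_measure \<nu>
  using levy by (rule levy_measure_sigma_finite)

sublocale pair_sigma_finite \<mu> \<nu> ..

lemma sets_nu [measurable_cong]: "sets \<nu> = sets borel"
  using levy by (simp add: levy_measure_def)

definition jump_form :: "('a \<Rightarrow> 'a) \<Rightarrow> ('a \<Rightarrow> 'a) \<Rightarrow> real" where
  "jump_form f g = (\<integral>z. inner (increment f z) (increment g z) \<partial>(\<mu> \<Otimes>\<^sub>M \<nu>))"

lemma measurable_increment [measurable]:
  assumes [measurable]: "f \<in> borel_measurable borel"
  shows "increment f \<in> borel_measurable (\<mu> \<Otimes>\<^sub>M \<nu>)"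
  unfolding increment_def by measurable

lemma jump_energy_eq_nn_integral:
  assumes [measurable]: "f \<in> borel_measurable borel"
  shows "jump_energy \<nu> \<mu> f = (\<integral>\<^sup>+z. ennreal ((norm (increment f z))\<^sup>2) \<partial>(\<mu> \<Otimes>\<^sub>M \<nu>))"
  unfolding jump_energy_def by (subst nu.nn_integral_fst[symmetric]) (auto simp: increment_def)

lemma H_space_iff:
  "f \<in> H_space \<nu> \<mu> \<longleftrightarrow> f \<in> borel_measurable borel \<and> square_integrable \<mu> f \<and>
     square_integrable (\<mu> \<Otimes>\<^sub>M \<nu>) (increment f)"
proof (cases "f \<in> borel_measurable borel")
  case [measurable]: True
  have "f \<in> borel_measurable \<mu>" by measurable
  then show ?thesis
    using measurable_increment[OF True] True
    by (simp add: H_space_def square_integrable_iff_nn_integral jump_energy_eq_nn_integral)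
qed (simp add: H_space_def)

lemma H0_spaceD:
  assumes "f \<in> H0_space \<nu> \<mu>"
  shows "f \<in> borel_measurable borel" "square_integrable \<mu> f"
    "square_integrable (\<mu> \<Otimes>\<^sub>M \<nu>) (increment f)" "(\<integral>y. f y \<partial>\<mu>) = 0"
  using assms by (auto simp: H0_space_def H_space_iff)

lemma jump_energy_eq:
  "f \<in> H0_space \<nu> \<mu> \<Longrightarrow> jump_energy \<nu> \<mu> f = ennreal (jump_form f f)"
  by (simp add: H0_spaceD jump_energy_eq_nn_integral nn_integral_norm_square jump_form_def)

text \<open>The increments are square integrable on the product, so their inner product is
  integrable there and Fubini applies.\<close>

lemma A_form_eq:
  assumes "f \<in> H0_space \<nu> \<mu>" "g \<in> H0_space \<nu> \<mu>"
  shows "A_form \<nu> \<mu> f g = jump_form f g"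
  using integral_fst'[OF square_integrable_inner[OF H0_spaceD(3)[OF assms(1)] H0_spaceD(3)[OF assms(2)]]]
  by (simp add: A_form_def jump_form_def increment_def)

lemma H0_space_comb:
  assumes "f \<in> H0_space \<nu> \<mu>" "g \<in> H0_space \<nu> \<mu>"
  shows "(\<lambda>x. f x + c *\<^sub>R g x) \<in> H0_space \<nu> \<mu>"
proof -
  note f = H0_spaceD[OF assms(1)] and g = H0_spaceD[OF assms(2)]
  note [measurable] = f(1) g(1)
  have "(\<lambda>x. f x + c *\<^sub>R g x) \<in> borel_measurable borel" by measurable
  moreover have "(\<integral>y. f y + c *\<^sub>R g y \<partial>\<mu>) = 0"
    using f g by (simp add: mu.square_integrable_imp_integrable)
  ultimately show ?thesis
    using f g by (simp add: H0_space_def H_space_iff increment_comb square_integrable_comb)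
qed

sublocale form: semidefinite_form "H0_space \<nu> \<mu>" jump_form
proof
  fix f g h :: "'a \<Rightarrow> 'a" and c :: real
  assume *: "f \<in> H0_space \<nu> \<mu>" "g \<in> H0_space \<nu> \<mu>"
  then show "(\<lambda>x. f x + c *\<^sub>R g x) \<in> H0_space \<nu> \<mu>"
    by (rule H0_space_comb)
  assume "h \<in> H0_space \<nu> \<mu>"
  with * show "jump_form (\<lambda>x. f x + c *\<^sub>R g x) h = jump_form f h + c * jump_form g h"
    by (simp add: jump_form_def increment_comb H0_spaceD L2.form_comb)
qed (simp_all add: jump_form_def inner_commute)

section \<open>Bounds from the Poincare inequality\<close>

lemma L2_le_jump_form:
  assumes "f \<in> H0_space \<nu> \<mu>"
  shows "(\<integral>y. inner (f y) (f y) \<partial>\<mu>) \<le> U * jump_form f f"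
proof -
  have "f \<in> H_space \<nu> \<mu>" using assms by (simp add: H0_space_def)
  then have "(\<integral>\<^sup>+y. ennreal ((norm (f y))\<^sup>2) \<partial>\<mu>) \<le> ennreal U * jump_energy \<nu> \<mu> f"
    using poincare H0_spaceD(4)[OF assms] by (force simp: poincare_inequality_def)
  then show ?thesis
    using assms U_pos form.form_nonneg[of f]
    by (simp add: nn_integral_norm_square H0_spaceD jump_energy_eq flip: ennreal_mult)
qed

text \<open>Cauchy-Schwarz in L2 of \<open>\<mu>\<close> against the identity, followed by the
  Poincare inequality. The constant is the one that reappears in the final energy bound.\<close>

lemma L_form_square_le:
  assumes "f \<in> H0_space \<nu> \<mu>"
  shows "(L_form \<mu> f)\<^sup>2 \<le> U * (\<integral>y. (norm y)\<^sup>2 \<partial>\<mu>) * jump_form f f"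
proof -
  have "(L_form \<mu> f)\<^sup>2 \<le> (\<integral>y. (norm y)\<^sup>2 \<partial>\<mu>) * (\<integral>y. inner (f y) (f y) \<partial>\<mu>)"
    using L2.form_Cauchy_Schwarz[of "\<lambda>y. y" \<mu> f] square_integrable_id H0_spaceD(2)[OF assms]
    by (simp add: L_form_def power2_norm_eq_inner)
  also have "\<dots> \<le> (\<integral>y. (norm y)\<^sup>2 \<partial>\<mu>) * (U * jump_form f f)"
    using L2_le_jump_form[OF assms] by (intro mult_left_mono) auto
  finally show ?thesis by (simp add: mult_ac)
qed

section \<open>Null sets under translation, and completeness\<close>

text \<open>The sum y + u has distribution \<open>\<nu> \<star> \<mu>\<close> under the product
  measure, so absolute continuity transfers \<open>\<mu>\<close>-null sets.\<close>

lemma AE_translate: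
  assumes "AE y in \<mu>. P y"
  shows "AE z in \<mu> \<Otimes>\<^sub>M \<nu>. P (fst z + snd z)"
proof -
  interpret swap: pair_sigma_finite \<nu> \<mu> ..
  have "AE y in \<nu> \<star> \<mu>. P y"
    using absolutely_continuous_AE[OF _ conv_ac assms] sets_mu by simp
  then have "AE z in \<nu> \<Otimes>\<^sub>M \<mu>. P (fst z + snd z)"
    unfolding convolution_def by (auto dest!: AE_distrD[rotated] simp: case_prod_unfold)
  \<comment> \<open>The convolution puts \<open>\<nu>\<close> first, whereas increments live on the
    product with \<open>\<mu>\<close> first; the factors are swapped here.\<close>
  then have "AE z in distr (\<mu> \<Otimes>\<^sub>M \<nu>) (\<nu> \<Otimes>\<^sub>M \<mu>) (\<lambda>(x, y). (y, x)). P (fst z + snd z)"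
    unfolding swap.distr_pair_swap[symmetric] .
  then show ?thesis
    by (auto dest!: AE_distrD[OF measurable_pair_swap'] simp: case_prod_unfold add.commute)
qed

text \<open>A null set times the whole space remains null even if \<open>\<nu>\<close> is infinite,
  by sigma-finiteness.\<close>

lemma AE_fst:
  assumes "AE y in \<mu>. P y"
  shows "AE z in \<mu> \<Otimes>\<^sub>M \<nu>. P (fst z)"
proof -
  from assms obtain N where "N \<in> null_sets \<mu>" and N: "{y \<in> space \<mu>. \<not> P y} \<subseteq> N"
    by (auto elim!: AE_E3)
  then have "N \<times> space \<nu> \<in> null_sets (\<mu> \<Otimes>\<^sub>M \<nu>)"
    by (intro nu.times_in_null_sets1) auto
  then show ?thesis
    by (rule AE_I') (use N in \<open>auto simp: space_pair_measure\<close>)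
qed

lemma AE_increment_tendsto:
  assumes "AE y in \<mu>. (\<lambda>n. F n y) \<longlonglongrightarrow> f y"
  shows "AE z in \<mu> \<Otimes>\<^sub>M \<nu>. (\<lambda>n. increment (F n) z) \<longlonglongrightarrow> increment f z"
  using AE_translate[OF assms] AE_fst[OF assms]
  by eventually_elim (auto simp: increment_def case_prod_unfold intro: tendsto_diff)

lemma H0_space_complete:
  assumes F: "\<And>n. F n \<in> H0_space \<nu> \<mu>"
    and Cauchy: "\<And>e. e > 0 \<Longrightarrow>
          \<exists>N. \<forall>i\<ge>N. \<forall>j\<ge>N. jump_form (\<lambda>x. F i x - F j x) (\<lambda>x. F i x - F j x) < e"
  shows "\<exists>t\<in>H0_space \<nu> \<mu>. (\<lambda>n. jump_form (\<lambda>x. F n x - t x) (\<lambda>x. F n x - t x)) \<longlonglongrightarrow> 0"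
proof -
  have F_meas [measurable]: "F n \<in> borel_measurable borel" for n
    using F by (rule H0_spaceD)
  have diff: "(\<lambda>x. F i x - F j x) \<in> H0_space \<nu> \<mu>" for i j
    using F by (intro form.diff_closed)
  \<comment> \<open>The theorem extracting an almost everywhere Cauchy subsequence is stated in L1,
    so control by the jump form is passed down through L2 to L1.\<close>
  have L1_le: "(\<integral>y. norm (F i y - F j y) \<partial>\<mu>)\<^sup>2
      \<le> U * jump_form (\<lambda>x. F i x - F j x) (\<lambda>x. F i x - F j x)" for i j
    using mu.expectation_norm_square_le[OF H0_spaceD(2)[OF diff]] L2_le_jump_form[OF diff]
    by (rule order_trans)
  have L1_Cauchy: "\<exists>N. \<forall>i\<ge>N. \<forall>j\<ge>N. (\<integral>y. norm (F i y - F j y) \<partial>\<mu>) < e" if "e > 0" for e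
  proof -
    obtain N where N: "\<And>i j. i \<ge> N \<Longrightarrow> j \<ge> N \<Longrightarrow>
        jump_form (\<lambda>x. F i x - F j x) (\<lambda>x. F i x - F j x) < e\<^sup>2 / U"
      using Cauchy[of "e\<^sup>2 / U"] \<open>e > 0\<close> U_pos by auto
    show ?thesis
    proof (intro exI allI impI)
      fix i j assume "N \<le> i" "N \<le> j"
      then have "U * jump_form (\<lambda>x. F i x - F j x) (\<lambda>x. F i x - F j x) < e\<^sup>2"
        using N U_pos by (simp add: field_simps)
      with L1_le[of i j] have "(\<integral>y. norm (F i y - F j y) \<partial>\<mu>)\<^sup>2 < e\<^sup>2" by linarith
      then show "(\<integral>y. norm (F i y - F j y) \<partial>\<mu>) < e"
        by (rule power_less_imp_less_base) (use \<open>e > 0\<close> in simp)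
    qed
  qed
  obtain r where r: "strict_mono r" and "AE y in \<mu>. Cauchy (\<lambda>i. F (r i) y)"
    using cauchy_L1_AE_cauchy_subseq[of \<mu> F, OF mu.square_integrable_imp_integrable L1_Cauchy]
      H0_spaceD(2)[OF F] by metis
  \<comment> \<open>Where the subsequence diverges \<open>lim\<close> has an arbitrary fixed value;
    \<open>t\<close> is Borel measurable all the same.\<close>
  define t where "t x = lim (\<lambda>i. F (r i) x)" for x
  have t_meas [measurable]: "t \<in> borel_measurable borel"
    unfolding t_def by measurable
  have lim: "AE y in \<mu>. (\<lambda>i. F (r i) y) \<longlonglongrightarrow> t y"
    using \<open>AE y in \<mu>. Cauchy (\<lambda>i. F (r i) y)\<close>
    by eventually_elim (simp add: t_def Cauchy_convergent_iff convergent_LIMSEQ_iff)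
  \<comment> \<open>Fix n in the Cauchy tail and let the other index run to infinity along
    \<open>r\<close>. Fatou then bounds both distances from \<open>F n\<close> to \<open>t\<close>,
    for every large n and not just along the subsequence.\<close>
  have close: "\<exists>N. \<forall>n\<ge>N. (\<integral>\<^sup>+y. ennreal ((norm (F n y - t y))\<^sup>2) \<partial>\<mu>) \<le> ennreal (U * e) \<and>
      (\<integral>\<^sup>+z. ennreal ((norm (increment (F n) z - increment t z))\<^sup>2) \<partial>(\<mu> \<Otimes>\<^sub>M \<nu>)) \<le> ennreal e"
    if "e > 0" for e
  proof -
    obtain N where N: "\<And>i j. i \<ge> N \<Longrightarrow> j \<ge> N \<Longrightarrow>
        jump_form (\<lambda>x. F i x - F j x) (\<lambda>x. F i x - F j x) < e"
      using Cauchy[OF \<open>e > 0\<close>] by auto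
    have ev: "\<forall>\<^sub>F i in sequentially. N \<le> r i"
      using filterlim_subseq[OF r] by (auto simp: filterlim_at_top)
    show ?thesis
    proof (intro exI allI impI conjI)
      fix n assume n: "N \<le> n"
      show "(\<integral>\<^sup>+y. ennreal ((norm (F n y - t y))\<^sup>2) \<partial>\<mu>) \<le> ennreal (U * e)"
      proof (rule Fatou_norm_square_diff[OF _ _ lim])
        show "\<forall>\<^sub>F i in sequentially.
            (\<integral>\<^sup>+y. ennreal ((norm (F n y - F (r i) y))\<^sup>2) \<partial>\<mu>) \<le> ennreal (U * e)"
          using ev
        proof eventually_elim
          case (elim i)
          have "U * jump_form (\<lambda>x. F n x - F (r i) x) (\<lambda>x. F n x - F (r i) x) \<le> U * e"
            using N[OF n elim] U_pos by simp
          with L2_le_jump_form[OF diff, of n "r i"] show ?case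
            by (simp add: nn_integral_norm_square[OF H0_spaceD(2)[OF diff]] ennreal_leI)
        qed
      qed measurable
      show "(\<integral>\<^sup>+z. ennreal ((norm (increment (F n) z - increment t z))\<^sup>2) \<partial>(\<mu> \<Otimes>\<^sub>M \<nu>)) \<le> ennreal e"
      proof (rule Fatou_norm_square_diff[OF _ _ AE_increment_tendsto[OF lim]])
        show "\<forall>\<^sub>F i in sequentially. (\<integral>\<^sup>+z. ennreal
            ((norm (increment (F n) z - increment (F (r i)) z))\<^sup>2) \<partial>(\<mu> \<Otimes>\<^sub>M \<nu>)) \<le> ennreal e"
          using ev
        proof eventually_elim
          case (elim i)
          then show ?case
            using N[OF n elim] nn_integral_norm_square[OF H0_spaceD(3)[OF diff], of n "r i"]
            by (simp add: increment_diff jump_form_def ennreal_leI)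
        qed
      qed measurable
    qed
  qed
  have sq: "square_integrable \<mu> (\<lambda>x. F n x - t x)"
    "square_integrable (\<mu> \<Otimes>\<^sub>M \<nu>) (\<lambda>z. increment (F n) z - increment t z)"
    if "(\<integral>\<^sup>+y. ennreal ((norm (F n y - t y))\<^sup>2) \<partial>\<mu>) \<le> ennreal (U * e)"
      "(\<integral>\<^sup>+z. ennreal ((norm (increment (F n) z - increment t z))\<^sup>2) \<partial>(\<mu> \<Otimes>\<^sub>M \<nu>)) \<le> ennreal e" for n e
  proof -
    show "square_integrable \<mu> (\<lambda>x. F n x - t x)"
      unfolding square_integrable_iff_nn_integral
    proof
      show "(\<lambda>x. F n x - t x) \<in> borel_measurable \<mu>" by measurable
    qed (use that(1) in \<open>simp add: le_less_trans\<close>)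
    show "square_integrable (\<mu> \<Otimes>\<^sub>M \<nu>) (\<lambda>z. increment (F n) z - increment t z)"
      unfolding square_integrable_iff_nn_integral
    proof
      show "(\<lambda>z. increment (F n) z - increment t z) \<in> borel_measurable (\<mu> \<Otimes>\<^sub>M \<nu>)" by measurable
    qed (use that(2) in \<open>simp add: le_less_trans\<close>)
  qed
  obtain n where n: "(\<integral>\<^sup>+y. ennreal ((norm (F n y - t y))\<^sup>2) \<partial>\<mu>) \<le> ennreal (U * 1)"
    "(\<integral>\<^sup>+z. ennreal ((norm (increment (F n) z - increment t z))\<^sup>2) \<partial>(\<mu> \<Otimes>\<^sub>M \<nu>)) \<le> ennreal 1"
    using close[of 1] by auto
  \<comment> \<open>\<open>t\<close> is recovered as F n - (F n - t), a difference of square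
    integrable functions; likewise for its increment.\<close>
  have t_sq: "square_integrable \<mu> t"
    using square_integrable_diff[OF H0_spaceD(2)[OF F[of n]] sq(1)[OF n]] by simp
  have "square_integrable (\<mu> \<Otimes>\<^sub>M \<nu>) (increment t)"
    using square_integrable_diff[OF H0_spaceD(3)[OF F[of n]] sq(2)[OF n]] by simp
  then have t_H: "t \<in> H_space \<nu> \<mu>" using t_sq t_meas by (simp add: H_space_iff)
  \<comment> \<open>Centering survives the limit: as \<open>F n\<close> has mean zero, the mean of
    \<open>t\<close> is at most the L2 distance from \<open>F n\<close> to \<open>t\<close>.
    Closeness at level e/U makes the squared distance at most e.\<close>
  have "(norm (\<integral>y. t y \<partial>\<mu>))\<^sup>2 \<le> 0 + e" if "e > 0" for e
  proof -
    obtain n where n: "(\<integral>\<^sup>+y. ennreal ((norm (F n y - t y))\<^sup>2) \<partial>\<mu>) \<le> ennreal (U * (e / U))"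
      "(\<integral>\<^sup>+z. ennreal ((norm (increment (F n) z - increment t z))\<^sup>2) \<partial>(\<mu> \<Otimes>\<^sub>M \<nu>)) \<le> ennreal (e / U)"
      using close[of "e / U"] \<open>e > 0\<close> U_pos by auto
    note sqn = sq(1)[OF n]
    have "(\<integral>y. F n y - t y \<partial>\<mu>) = - (\<integral>y. t y \<partial>\<mu>)"
      using H0_spaceD(2,4)[OF F[of n]] t_sq by (simp add: mu.square_integrable_imp_integrable)
    then have "norm (\<integral>y. t y \<partial>\<mu>) \<le> (\<integral>y. norm (F n y - t y) \<partial>\<mu>)"
      using integral_norm_bound[of \<mu> "\<lambda>y. F n y - t y"] by simp
    then have "(norm (\<integral>y. t y \<partial>\<mu>))\<^sup>2 \<le> (\<integral>y. norm (F n y - t y) \<partial>\<mu>)\<^sup>2"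
      by (intro power_mono) auto
    also have "\<dots> \<le> (\<integral>y. inner (F n y - t y) (F n y - t y) \<partial>\<mu>)"
      by (rule mu.expectation_norm_square_le[OF sqn])
    also have "\<dots> \<le> e"
      using n(1) \<open>e > 0\<close> U_pos by (simp add: nn_integral_norm_square[OF sqn])
    finally show ?thesis by simp
  qed
  then have "(norm (\<integral>y. t y \<partial>\<mu>))\<^sup>2 \<le> 0" by (rule field_le_epsilon)
  then have t_H0: "t \<in> H0_space \<nu> \<mu>" using t_H by (simp add: H0_space_def)
  have "(\<lambda>n. jump_form (\<lambda>x. F n x - t x) (\<lambda>x. F n x - t x)) \<longlonglongrightarrow> 0"
  proof (rule LIMSEQ_I)
    fix e :: real assume "e > 0"
    \<comment> \<open>\<open>close\<close> gives a non-strict bound, hence e/2 for the strict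
      one.\<close>
    then obtain N where N: "\<And>n. n \<ge> N \<Longrightarrow>
        (\<integral>\<^sup>+z. ennreal ((norm (increment (F n) z - increment t z))\<^sup>2) \<partial>(\<mu> \<Otimes>\<^sub>M \<nu>)) \<le> ennreal (e / 2)"
      using close[of "e / 2"] by auto
    show "\<exists>N. \<forall>n\<ge>N. norm (jump_form (\<lambda>x. F n x - t x) (\<lambda>x. F n x - t x) - 0) < e"
    proof (intro exI allI impI)
      fix n assume "N \<le> n"
      have "(\<lambda>x. F n x - t x) \<in> H0_space \<nu> \<mu>" using F t_H0 by (rule form.diff_closed)
      then have "ennreal (jump_form (\<lambda>x. F n x - t x) (\<lambda>x. F n x - t x)) \<le> ennreal (e / 2)"
        using N[OF \<open>N \<le> n\<close>]
        by (simp add: jump_energy_eq_nn_integral H0_spaceD increment_diff flip: jump_energy_eq)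
      then show "norm (jump_form (\<lambda>x. F n x - t x) (\<lambda>x. F n x - t x) - 0) < e"
        using \<open>e > 0\<close> form.form_nonneg[of "\<lambda>x. F n x - t x"] by (simp add: ennreal_le_iff)
    qed
  qed
  with t_H0 show ?thesis by blast
qed

section \<open>Existence, uniqueness and energy of the representative\<close>

theorem stein_kernel_exists:
  "\<exists>\<tau>\<in>H0_space \<nu> \<mu>. \<forall>f\<in>H0_space \<nu> \<mu>. A_form \<nu> \<mu> f \<tau> = L_form \<mu> f"
proof -
  have "\<exists>\<tau>\<in>H0_space \<nu> \<mu>. \<forall>f\<in>H0_space \<nu> \<mu>. jump_form f \<tau> = L_form \<mu> f"
  proof (rule form.riesz_representation)
    have "(\<lambda>_. 0) \<in> H0_space \<nu> \<mu>"
      by (simp add: H0_space_def H_space_def jump_energy_def)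
    then show "H0_space \<nu> \<mu> \<noteq> {}" by blast
    show "L_form \<mu> (\<lambda>x. f x + c *\<^sub>R g x) = L_form \<mu> f + c * L_form \<mu> g"
      if "f \<in> H0_space \<nu> \<mu>" "g \<in> H0_space \<nu> \<mu>" for f g c
      using that square_integrable_id
      by (simp add: L_form_def inner_add_right square_integrable_inner H0_spaceD)
    show "(L_form \<mu> f)\<^sup>2 \<le> U * (\<integral>y. (norm y)\<^sup>2 \<partial>\<mu>) * jump_form f f"
      if "f \<in> H0_space \<nu> \<mu>" for f
      using that by (rule L_form_square_le)
    show "0 \<le> U * (\<integral>y. (norm y)\<^sup>2 \<partial>\<mu>)"
      using U_pos by simp
  qed (rule H0_space_complete)
  then show ?thesis by (metis A_form_eq)
qed

text \<open>Testing both equations with the difference d shows that its jump form is zero; the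
  Poincare inequality then kills its L2 norm, which determines d only \<open>\<mu>\<close>-almost
  everywhere.\<close>

theorem stein_kernel_unique:
  assumes "\<sigma> \<in> H0_space \<nu> \<mu>" "\<tau> \<in> H0_space \<nu> \<mu>"
    and \<sigma>: "\<forall>f\<in>H0_space \<nu> \<mu>. A_form \<nu> \<mu> f \<sigma> = L_form \<mu> f"
    and \<tau>: "\<forall>f\<in>H0_space \<nu> \<mu>. A_form \<nu> \<mu> f \<tau> = L_form \<mu> f"
  shows "AE y in \<mu>. \<sigma> y = \<tau> y"
proof -
  let ?d = "\<lambda>x. \<sigma> x - \<tau> x"
  have d: "?d \<in> H0_space \<nu> \<mu>"
    using assms by (intro form.diff_closed)
  have "jump_form ?d ?d = jump_form ?d \<sigma> - jump_form ?d \<tau>"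
    using form.form_diff[OF assms(1,2) d] by (metis form.form_sym)
  also have "\<dots> = 0"
    using \<sigma> \<tau> d assms(1,2) A_form_eq by auto
  finally have "(\<integral>y. inner (?d y) (?d y) \<partial>\<mu>) \<le> 0"
    using L2_le_jump_form[OF d] by simp
  then have "(\<integral>\<^sup>+y. ennreal ((norm (?d y))\<^sup>2) \<partial>\<mu>) = 0"
    by (simp add: nn_integral_norm_square[OF H0_spaceD(2)[OF d]] ennreal_eq_0_iff)
  moreover have "(\<lambda>y. ennreal ((norm (?d y))\<^sup>2)) \<in> borel_measurable \<mu>"
    using H0_spaceD(1)[OF d] by measurable
  ultimately have "AE y in \<mu>. ennreal ((norm (?d y))\<^sup>2) = 0"
    by (simp add: nn_integral_0_iff_AE)
  then show ?thesis
    by eventually_elim (simp add: ennreal_eq_0_iff)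
qed

text \<open>Testing with \<open>\<tau>\<close> itself turns the bound on \<open>L\<close> into x^2
  \<le> C x for the energy x. Dividing by x is possible when x > 0, and x = 0 is covered by C \<ge>
  0.\<close>

theorem stein_kernel_energy_le:
  assumes "\<tau> \<in> H0_space \<nu> \<mu>" "\<forall>f\<in>H0_space \<nu> \<mu>. A_form \<nu> \<mu> f \<tau> = L_form \<mu> f"
  shows "jump_energy \<nu> \<mu> \<tau> \<le> ennreal (U * (\<integral>y. (norm y)\<^sup>2 \<partial>\<mu>))"
proof -
  let ?C = "U * (\<integral>y. (norm y)\<^sup>2 \<partial>\<mu>)"
  have "(jump_form \<tau> \<tau>)\<^sup>2 \<le> ?C * jump_form \<tau> \<tau>"
    using L_form_square_le[OF assms(1)] assms A_form_eq by force
  then have "jump_form \<tau> \<tau> \<le> ?C" if "jump_form \<tau> \<tau> > 0"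
    using that by (simp add: power2_eq_square)
  moreover have "0 \<le> ?C" using U_pos by simp
  ultimately have "jump_form \<tau> \<tau> \<le> ?C" by linarith
  then show ?thesis
    using assms(1) by (simp add: jump_energy_eq ennreal_leI)
qed

end

theorem theorem4p2:
  fixes M :: "'w measure"
    and Y :: "'w \<Rightarrow> real ^ 'd"
    and \<mu> \<nu> :: "(real ^ 'd) measure"
    and U :: real
  assumes "prob_space M"
    and "Y \<in> borel_measurable M"
    and "\<mu> = distr M borel Y"
    and "(\<integral>\<^sup>+\<omega>. ennreal ((norm (Y \<omega>))\<^sup>2) \<partial>M) < \<infinity>"
    and "(\<integral>\<omega>. Y \<omega> \<partial>M) = 0"
    and "nondegenerate_law \<mu>"
    and "levy_measure \<nu>"
    and "(\<integral>\<^sup>+u\<in>{u. norm u \<ge> 1}. ennreal ((norm u)\<^sup>2) \<partial>\<nu>) < \<infinity>"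
    and "absolutely_continuous \<mu> (\<nu> \<star> \<mu>)"
    and "0 < U"
    and "poincare_inequality \<nu> \<mu> U"
  shows "(\<exists>\<tau> \<in> H0_space \<nu> \<mu>.
            (\<forall>f \<in> H0_space \<nu> \<mu>. A_form \<nu> \<mu> f \<tau> = L_form \<mu> f) \<and>
            (\<forall>\<sigma> \<in> H0_space \<nu> \<mu>.
               (\<forall>f \<in> H0_space \<nu> \<mu>. A_form \<nu> \<mu> f \<sigma> = L_form \<mu> f) \<longrightarrow>
               (AE y in \<mu>. \<sigma> y = \<tau> y))) \<and>
         (\<forall>\<tau> \<in> H0_space \<nu> \<mu>.
            (\<forall>f \<in> H0_space \<nu> \<mu>. A_form \<nu> \<mu> f \<tau> = L_form \<mu> f) \<longrightarrow>
            jump_energy \<nu> \<mu> \<tau> \<le> ennreal (U * (\<integral>\<omega>. (norm (Y \<omega>))\<^sup>2 \<partial>M)))"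
proof -
  interpret M: prob_space M by fact
  note [measurable] = assms(2)
  \<comment> \<open>The energy bound is stated with the second moment of Y, while the locale uses
    that of its law; the change of variables identifies them.\<close>
  have second: "(\<integral>y. (norm y)\<^sup>2 \<partial>\<mu>) = (\<integral>\<omega>. (norm (Y \<omega>))\<^sup>2 \<partial>M)"
    unfolding assms(3) by (rule integral_distr) measurable
  interpret poincare_jump \<mu> \<nu> U
  proof (rule poincare_jump.intro)
    show "prob_space \<mu>" unfolding assms(3) by (rule M.prob_space_distr) measurable
    show "sets \<mu> = sets borel" by (simp add: assms(3))
    show "square_integrable \<mu> (\<lambda>y. y)"
      using assms(4) unfolding square_integrable_iff_nn_integral assms(3)
      by (simp add: nn_integral_distr)
  qed (use assms in auto)
  show ?thesis
    using stein_kernel_exists stein_kernel_unique stein_kernel_energy_le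
    unfolding second by blast
qed

end
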